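(* Let $k, M$ be non-negative integers such that $k \ge 5$, $M \ge b_k$ and $2^M \ge M - b_k + \nu_2(k!)$. For each $j \in \mathcal{N}_{k,M}$ let $\ell_j$ be a non-negative integer. Suppose that for every integer $n \ge k$ such that $n \equiv j \pmod{2^M}$ for some $j \in \mathcal{N}_{k,M}$, the following two conditions hold for all integers $m \ge M$: (i) $S([n]_{2^m},k)$ is not constant modulo $2^{m-b_k+\ell_j+1}$; (ii) $S([n]_{2^m},k)$ is constant modulo $2^{m-b_k+\ell_j}$. Then for every integer $m \ge M$: (a) the number of integers $n$ with $k \le n < k+2^m$ such that $\nu_2 \circ S(\cdot,k)$ is non-constant on $[n]_{2^m}$ equals $\#\mathcal{N}_{k,M}$; and (b) for every integer $n \ge k$, if $\nu_2\circ S(\cdot,k)$ is non-constant on $[n]_{2^m}$, then $\nu_2\circ S(\cdot,k)$ is non-constant on exactly one of the two classes $[n]_{2^{m+1}}$ and $[n+2^m]_{2^{m+1}}$. In other words, the Amdeberhan–Manna–Moll conjecture holds for $k$ with $\mu_k = \#\mathcal{N}_{k,M}$ and $M_k \le M$.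
   Context: $S(n,k)$ denotes the Stirling number of the second kind (the number of partitions of an $n$-element set into $k$ nonempty blocks); for fixed $k$ it is regarded as a function of $n \ge k$. For a positive integer $z$, $\nu_2(z)=\max\{i\in\mathbb{N}: 2^i \mid z\}$. For $n,t \in \mathbb{N}$, $[n]_t = \{ j \in \mathbb{N} : j \ge \max\{n,t\},\ j \equiv n \pmod t\}$; the classes $[n]_{2^{m+1}}$ and $[n+2^m]_{2^{m+1}}$ are called the children of $[n]_{2^m}$. For a function $f$ and a set $A$ in its domain, $f(A)=\{f(a):a\in A\}$, and $f$ is constant on $A$ if $f(A)$ is a singleton. A set $A$ of integers is constant modulo $Q$ if all its elements are congruent to one another modulo $Q$. $b_k = \lceil \log_2 k\rceil - 2$. For positive integers $k,m$, $\mathcal{N}_{k,m} = \{ n \in \mathbb{N} : k \le n < k+2^m \text{ and } \nu_2\circ S(\cdot,k) \text{ is non-constant on } [n]_{2^m}\}$. The Amdeberhan–Manna–Moll conjecture for $k$ asserts existence of $M_k,\mu_k$ such that for all $m\ge M_k$, there are exactly $\mu_k$ classes $[n]_{2^m}$ on which $\nu_2\circ S(\cdot,k)$ is non-constant, and each such class has exactly one child on which it is non-constant. *)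

theory Defs
  imports
    Complex_Main
    "HOL-Combinatorics.Stirling"
    "HOL-Number_Theory.Cong"
begin

definition nu2 :: "nat \<Rightarrow> nat" where
  "nu2 z = multiplicity 2 z"

definition res_class :: "nat \<Rightarrow> nat \<Rightarrow> nat set" where
  "res_class n t = {j. j \<ge> max n t \<and> [j = n] (mod t)}"

definition is_constant_on :: "('a \<Rightarrow> 'b) \<Rightarrow> 'a set \<Rightarrow> bool" where
  "is_constant_on f A \<longleftrightarrow> is_singleton (f ` A)"

definition constant_modulo :: "nat set \<Rightarrow> nat \<Rightarrow> bool" where
  "constant_modulo A Q \<longleftrightarrow> (\<forall>x\<in>A. \<forall>y\<in>A. [x = y] (mod Q))"

definition bb :: "nat \<Rightarrow> int" where
  "bb k = \<lceil>log 2 (real k)\<rceil> - 2"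

definition nu2_S_nonconstant :: "nat \<Rightarrow> nat set \<Rightarrow> bool" where
  "nu2_S_nonconstant k A \<longleftrightarrow> \<not> is_constant_on (\<lambda>n. nu2 (Stirling n k)) A"

definition NN :: "nat \<Rightarrow> nat \<Rightarrow> nat set" where
  "NN k m = {n. k \<le> n \<and> n < k + 2 ^ m \<and> nu2_S_nonconstant k (res_class n (2 ^ m))}"

definition children :: "nat \<Rightarrow> nat \<Rightarrow> nat set set" where
  "children n m = {res_class n (2 ^ (m + 1)), res_class (n + 2 ^ m) (2 ^ (m + 1))}"

text \<open>The Amdeberhan--Manna--Moll conjecture for \<open>k\<close> asserts that some \<open>Mk\<close> and \<open>\<mu>\<close> satisfy the
  following predicate. Since \<open>res_class n t\<close> loses its initial elements as \<open>n\<close> grows, each residue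
  modulo \<open>2^m\<close> is counted only once, through its representative \<open>n\<close> with \<open>k \<le> n < k + 2^m\<close>.\<close>

definition AMM_holds_with :: "nat \<Rightarrow> nat \<Rightarrow> nat \<Rightarrow> bool" where
  "AMM_holds_with k Mk \<mu> \<longleftrightarrow>
     (\<forall>m\<ge>Mk.
        card {C. nu2_S_nonconstant k C \<and>
                 (\<exists>n. k \<le> n \<and> n < k + 2 ^ m \<and> C = res_class n (2 ^ m))} = \<mu> \<and>
        (\<forall>n\<ge>k. nu2_S_nonconstant k (res_class n (2 ^ m)) \<longrightarrow>
           (\<exists>!C. C \<in> children n m \<and> nu2_S_nonconstant k C)))"

end

theory Submission
  imports Defs
begin

text \<open>Write \<open>e = m - b\<^sub>k + \<ell>\<^sub>j\<close>. On a class modulo \<open>2^m\<close> lying over some \<open>j \<in> \<N>\<^sub>k\<^sub>,\<^sub>M\<close> the values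
  \<open>S(\<cdot>,k)\<close> agree modulo \<open>2^e\<close> but not modulo \<open>2^(e+1)\<close>; hence \<open>\<nu>\<^sub>2 \<circ> S(\<cdot>,k)\<close> is non-constant there
  exactly when \<open>2^e\<close> divides these values. In that case they take both residues \<open>0\<close> and \<open>2^e\<close> modulo
  \<open>2^(e+1)\<close>, whereas each child sees only one of them, so exactly one child is
  divisible by \<open>2^(e+1)\<close>, that is, non-constant. Classes that are non-constant at level \<open>m + 1\<close> lie
  over non-constant classes at level \<open>m\<close>, so their number does not change with \<open>m\<close>.\<close>

text \<open>For \<open>i \<le> e\<close> the congruence transfers divisibility by
  \<open>2 ^ i\<close>; for larger \<open>i\<close> neither number is divisible. So the same powers
  of 2 divide both.\<close>

lemma nu2_eq_if_cong:
  assumes "[x = y] (mod 2 ^ e)" and "\<not> 2 ^ e dvd x"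
  shows "nu2 x = nu2 y"
proof -
  have "2 ^ i dvd x \<longleftrightarrow> 2 ^ i dvd y" for i
  proof (cases "i \<le> e")
    case True
    then have "[x = y] (mod 2 ^ i)"
      using assms(1) cong_dvd_modulus_nat le_imp_power_dvd by blast
    then show ?thesis
      using cong_dvd_iff by blast
  next
    case False
    have "\<not> 2 ^ e dvd y"
      using assms cong_dvd_iff by blast
    then show ?thesis
      using False assms(2) by (meson dvd_trans le_imp_power_dvd nat_le_linear)
  qed
  then show ?thesis
    unfolding nu2_def by (intro multiplicity_cong) auto
qed

text \<open>The empty set counts as non-constant, its image not being a singleton, so
  \<open>B\<close> must be nonempty.\<close>

lemma is_constant_on_subset:
  assumes "is_constant_on f A" and "B \<subseteq> A" and "B \<noteq> {}"
  shows "is_constant_on f B"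
  using assms unfolding is_constant_on_def is_singleton_def
  by (metis image_is_empty image_mono subset_singletonD)

lemma is_constant_onD:
  assumes "is_constant_on f A" and "x \<in> A" and "y \<in> A"
  shows "f x = f y"
  using assms unfolding is_constant_on_def is_singleton_def by (metis imageI singletonD)

text \<open>The quotients by \<open>2 ^ e\<close> are incongruent modulo 2, so exactly one of them
  is even.\<close>

lemma dvd_differs_if_not_cong:
  fixes u v :: nat
  assumes "2 ^ e dvd u" and "2 ^ e dvd v" and "\<not> [u = v] (mod 2 ^ (e + 1))"
  shows "2 ^ (e + 1) dvd u \<longleftrightarrow> \<not> 2 ^ (e + 1) dvd v"
proof -
  obtain a b where ab: "u = 2 ^ e * a" "v = 2 ^ e * b"
    using assms(1,2) by (elim dvdE)
  have "\<not> [a = b] (mod 2)"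
    using assms(3) cong_cmult_leftI[of a b 2 "2 ^ e"] by (auto simp: ab mult.commute)
  then have "even a \<longleftrightarrow> odd b"
    unfolding cong_def by presburger
  moreover have "2 ^ (e + 1) dvd 2 ^ e * c \<longleftrightarrow> even c" for c :: nat
    by (simp only: power_add power_one_right nat_mult_dvd_cancel1[OF zero_less_power] zero_less_numeral)
  ultimately show ?thesis
    by (simp only: ab)
qed

lemma nu2_nonconstant_iff_dvd:
  assumes pos: "\<And>x. x \<in> A \<Longrightarrow> f x > 0"
    and const: "constant_modulo (f ` A) (2 ^ e)"
    and nonconst: "\<not> constant_modulo (f ` A) (2 ^ (e + 1))"
    and "x \<in> A"
  shows "\<not> is_constant_on (\<lambda>n. nu2 (f n)) A \<longleftrightarrow> 2 ^ e dvd f x"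
proof
  assume *: "\<not> is_constant_on (\<lambda>n. nu2 (f n)) A"
  show "2 ^ e dvd f x"
  proof (rule ccontr)
    assume ndvd: "\<not> 2 ^ e dvd f x"
    have "nu2 (f y) = nu2 (f x)" if "y \<in> A" for y
    proof -
      have "[f x = f y] (mod 2 ^ e)"
        using const that \<open>x \<in> A\<close> by (auto simp: constant_modulo_def)
      then show ?thesis
        using nu2_eq_if_cong ndvd by metis
    qed
    then have "(\<lambda>n. nu2 (f n)) ` A = (\<lambda>_. nu2 (f x)) ` A"
      by (intro image_cong refl)
    also have "\<dots> = {nu2 (f x)}"
      using \<open>x \<in> A\<close> by (rule image_constant)
    finally have "(\<lambda>n. nu2 (f n)) ` A = {nu2 (f x)}" .
    then show False
      using * by (simp add: is_constant_on_def)
  qed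
next
  assume dvd: "2 ^ e dvd f x"
  obtain y z where yz: "y \<in> A" "z \<in> A" "\<not> [f y = f z] (mod 2 ^ (e + 1))"
    using nonconst by (auto simp: constant_modulo_def)
  have all: "2 ^ e dvd f w" if "w \<in> A" for w
    using const that dvd \<open>x \<in> A\<close> cong_dvd_iff[of "f x" "f w" "2 ^ e"]
    by (auto simp: constant_modulo_def)
  have "2 ^ (e + 1) dvd f y \<longleftrightarrow> \<not> 2 ^ (e + 1) dvd f z"
    using yz all dvd_differs_if_not_cong by blast
  \<comment> \<open>Positivity enters here: every power of 2 divides 0, while
    \<open>multiplicity 2 0\<close> is 0.\<close>
  moreover have "2 ^ i dvd f w \<longleftrightarrow> i \<le> nu2 (f w)" if "w \<in> A" for w i
    unfolding nu2_def using pos[OF that] by (intro power_dvd_iff_le_multiplicity) auto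
  ultimately have "nu2 (f y) \<noteq> nu2 (f z)"
    using yz by metis
  then show "\<not> is_constant_on (\<lambda>n. nu2 (f n)) A"
    using is_constant_onD[of "\<lambda>n. nu2 (f n)"] yz by blast
qed

lemma Stirling_pos: "1 \<le> k \<Longrightarrow> k \<le> n \<Longrightarrow> Stirling n k > 0"
proof (induction n k rule: Stirling.induct)
  case (4 n k)
  then show ?case
    by (cases "k = n"; cases k) auto
qed auto

text \<open>A class starts at \<open>max n t\<close>, so congruence alone does not give inclusion;
  \<open>n' \<le> n\<close> and \<open>t \<le> t'\<close> ensure that the right-hand class starts no
  later.\<close>

lemma res_class_mono:
  assumes "[n = n'] (mod t)" and "n' \<le> n" and "t dvd t'" and "0 < t'"
  shows "res_class n t' \<subseteq> res_class n' t"
proof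
  fix x assume x: "x \<in> res_class n t'"
  then have "[x = n] (mod t)"
    using assms(3) cong_dvd_modulus_nat by (auto simp: res_class_def)
  then show "x \<in> res_class n' t"
    using x assms dvd_imp_le[OF assms(3,4)] cong_trans[of x n t n'] by (auto simp: res_class_def)
qed

text \<open>The case \<open>i = 0\<close> is excluded because \<open>n\<close> may lie below
  \<open>t\<close>.\<close>

lemma add_mult_in_res_class: "0 < i \<Longrightarrow> n + i * t \<in> res_class n t"
  by (cases i) (auto simp: res_class_def cong_def add.assoc[symmetric])

lemma res_class_nonempty: "res_class n t \<noteq> {}"
  using add_mult_in_res_class[of 1] by fastforce

lemma nu2_S_nonconstant_mono:
  assumes "nu2_S_nonconstant k (res_class n t')"
    and "[n = n'] (mod t)" and "n' \<le> n" and "t dvd t'" and "0 < t'"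
  shows "nu2_S_nonconstant k (res_class n' t)"
  using assms is_constant_on_subset[OF _ res_class_mono res_class_nonempty]
  unfolding nu2_S_nonconstant_def by blast

text \<open>Links the count of classes as sets in \<open>AMM_holds_with\<close> to the count of
  representatives in \<open>NN\<close>. A common element makes the representatives congruent, and
  they lie in a window of length \<open>t\<close>.\<close>

lemma inj_on_res_class: "inj_on (\<lambda>n. res_class n t) {k..<k + t}"
proof (rule inj_onI)
  fix n n' assume nn: "n \<in> {k..<k + t}" "n' \<in> {k..<k + t}" "res_class n t = res_class n' t"
  obtain x where "x \<in> res_class n t"
    using res_class_nonempty by blast
  then have "[x = n] (mod t)" "[x = n'] (mod t)"
    using nn(3) by (auto simp: res_class_def)
  then have c: "[n = n'] (mod t)"
    using cong_sym cong_trans by blast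
  have "[n - k = n' - k] (mod t)"
    using c nn(1,2) cong_add_lcancel_nat[of k "n - k" "n' - k" t] by simp
  then show "n = n'"
    using nn(1,2) cong_less_modulus_unique_nat[of "n - k" "n' - k" t] by simp linarith
qed

text \<open>Write \<open>x = n + 2 ^ (m + 1) + 2 ^ m * q\<close>: the parity of \<open>q\<close>
  selects the child, and the offset puts \<open>x\<close> above the start of that child.\<close>

lemma in_child_if_in_res_class:
  assumes "x \<in> res_class (n + 2 ^ (m + 1)) (2 ^ m)"
  shows "x \<in> res_class n (2 ^ (m + 1)) \<or> x \<in> res_class (n + 2 ^ m) (2 ^ (m + 1))"
proof -
  have ge: "x \<ge> n + 2 ^ (m + 1)" and "[x = n + 2 ^ (m + 1)] (mod 2 ^ m)"
    using assms by (auto simp: res_class_def)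
  then have "2 ^ m dvd x - (n + 2 ^ (m + 1))"
    using cong_altdef_nat by blast
  then obtain q where "x - (n + 2 ^ (m + 1)) = 2 ^ m * q"
    by (elim dvdE)
  then have q: "x = n + 2 ^ (m + 1) + 2 ^ m * q"
    using ge by linarith
  consider p where "q = 2 * p" | p where "q = 2 * p + 1"
    by (metis evenE oddE)
  then show ?thesis
  proof cases
    case 1
    then have "x = n + (p + 1) * 2 ^ (m + 1)"
      using q by (simp add: algebra_simps)
    then show ?thesis
      using add_mult_in_res_class[of "p + 1" n "2 ^ (m + 1)"] by simp
  next
    case 2
    then have "x = (n + 2 ^ m) + (p + 1) * 2 ^ (m + 1)"
      using q by (simp add: algebra_simps)
    then show ?thesis
      using add_mult_in_res_class[of "p + 1" "n + 2 ^ m" "2 ^ (m + 1)"] by simp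
  qed
qed

text \<open>Non-constancy passes to larger classes, so the representative of \<open>n\<close> in the
  window \<open>[k, k + 2^M)\<close> lies in \<open>NN k M\<close>. This makes the hypotheses on
  \<open>j\<close> applicable to every non-constant class.\<close>

lemma nonconstant_over_NN:
  assumes "n \<ge> k" and "M \<le> m" and "nu2_S_nonconstant k (res_class n (2 ^ m))"
  shows "\<exists>j\<in>NN k M. [n = j] (mod 2 ^ M)"
proof -
  define j where "j = k + (n - k) mod 2 ^ M"
  have "j \<le> n"
    using assms(1) mod_less_eq_dividend[of "n - k" "2 ^ M"] unfolding j_def by linarith
  moreover have "[n = j] (mod 2 ^ M)"
    using assms(1) unfolding j_def cong_def by (metis le_add_diff_inverse mod_add_right_eq)
  moreover have "nu2_S_nonconstant k (res_class j (2 ^ M))"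
    using assms(2,3) calculation by (elim nu2_S_nonconstant_mono) (auto simp: le_imp_power_dvd)
  ultimately show ?thesis
    unfolding NN_def by (intro bexI[of _ j]) (auto simp: j_def)
qed

text \<open>Reduction to the representative in \<open>[k, k + 2^m)\<close> is a bijection \<open>NN k (m + 1) \<rightarrow> NN k m\<close>.\<close>

lemma card_NN_Suc:
  assumes split: "\<And>n. n \<in> NN k m \<Longrightarrow>
      nu2_S_nonconstant k (res_class n (2 ^ (m + 1))) \<noteq>
      nu2_S_nonconstant k (res_class (n + 2 ^ m) (2 ^ (m + 1)))"
  shows "card (NN k (m + 1)) = card (NN k m)"
proof -
  define g where "g n = (if n < k + 2 ^ m then n else n - 2 ^ m)" for n
  have g_eq: "g n = n \<or> n = g n + 2 ^ m" for n
    by (auto simp: g_def)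
  have g_in: "g n \<in> NN k m" if "n \<in> NN k (m + 1)" for n
  proof -
    have "nu2_S_nonconstant k (res_class (g n) (2 ^ m))"
    proof (rule nu2_S_nonconstant_mono)
      show "nu2_S_nonconstant k (res_class n (2 ^ (m + 1)))"
        using that by (simp add: NN_def)
      show "[n = g n] (mod 2 ^ m)"
        using g_eq[of n] by (auto simp: cong_def) (metis mod_add_self2)
    qed (auto simp: g_def)
    then show ?thesis
      using that by (auto simp: NN_def g_def)
  qed
  have "bij_betw g (NN k (m + 1)) (NN k m)"
  proof (rule bij_betw_imageI)
    show "inj_on g (NN k (m + 1))"
    proof (rule inj_onI)
      fix n n' assume n: "n \<in> NN k (m + 1)" and n': "n' \<in> NN k (m + 1)" and eq: "g n = g n'"
      \<comment> \<open>Otherwise \<open>n\<close> and \<open>n'\<close> would be \<open>g n\<close>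
        and \<open>g n + 2 ^ m\<close> in some order, and both children of \<open>g n\<close> would
        be non-constant, against \<open>split\<close>.\<close>
      show "n = n'"
        using g_eq[of n] g_eq[of n'] split[OF g_in[OF n]] n n' eq by (auto simp: NN_def)
    qed
    show "g ` NN k (m + 1) = NN k m"
    proof
      show "g ` NN k (m + 1) \<subseteq> NN k m"
        using g_in by blast
      show "NN k m \<subseteq> g ` NN k (m + 1)"
      proof
        fix n assume n: "n \<in> NN k m"
        have "g n = n" "g (n + 2 ^ m) = n"
          using n by (auto simp: NN_def g_def)
        moreover have "n \<in> NN k (m + 1) \<or> n + 2 ^ m \<in> NN k (m + 1)"
          using split[OF n] n by (auto simp: NN_def)
        ultimately show "n \<in> g ` NN k (m + 1)"
          by (metis imageI)
      qed
    qed
  qed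
  then show ?thesis
    by (rule bij_betw_same_card)
qed

theorem theorem4p3:
  fixes k M :: nat and l :: "nat \<Rightarrow> nat"
  assumes "k \<ge> 5"
    and "int M \<ge> bb k"
    and "2 ^ M \<ge> int M - bb k + int (nu2 (fact k))"
    and "\<And>n j m. n \<ge> k \<Longrightarrow> j \<in> NN k M \<Longrightarrow> [n = j] (mod 2 ^ M) \<Longrightarrow> m \<ge> M \<Longrightarrow>
           \<not> constant_modulo ((\<lambda>i. Stirling i k) ` res_class n (2 ^ m))
               (2 ^ nat (int m - bb k + int (l j) + 1))"
    and "\<And>n j m. n \<ge> k \<Longrightarrow> j \<in> NN k M \<Longrightarrow> [n = j] (mod 2 ^ M) \<Longrightarrow> m \<ge> M \<Longrightarrow>
           constant_modulo ((\<lambda>i. Stirling i k) ` res_class n (2 ^ m))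
             (2 ^ nat (int m - bb k + int (l j)))"
  shows "(\<forall>m\<ge>M.
            card {n. k \<le> n \<and> n < k + 2 ^ m \<and> nu2_S_nonconstant k (res_class n (2 ^ m))}
              = card (NN k M) \<and>
            (\<forall>n\<ge>k. nu2_S_nonconstant k (res_class n (2 ^ m)) \<longrightarrow>
               nu2_S_nonconstant k (res_class n (2 ^ (m + 1))) \<noteq>
               nu2_S_nonconstant k (res_class (n + 2 ^ m) (2 ^ (m + 1)))))
         \<and> (\<exists>Mk\<le>M. AMM_holds_with k Mk (card (NN k M)))"
proof -
  let ?S = "\<lambda>i. Stirling i k"
  define e where "e j m = nat (int m - bb k + int (l j))" for j m
  \<comment> \<open>As \<open>bb k \<le> M \<le> m\<close>, the argument of \<open>nat\<close> is
    nonnegative and nothing is truncated.\<close>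
  have e_Suc: "e j (m + 1) = e j m + 1" and e_plus: "nat (int m - bb k + int (l j) + 1) = e j m + 1"
    if "m \<ge> M" for j m
    using that assms(2) by (auto simp: e_def)
  have const: "constant_modulo (?S ` res_class n (2 ^ m)) (2 ^ e j m)"
    and nonconst: "\<not> constant_modulo (?S ` res_class n (2 ^ m)) (2 ^ (e j m + 1))"
    if "n \<ge> k" "j \<in> NN k M" "[n = j] (mod 2 ^ M)" "m \<ge> M" for n j m
    using assms(4,5)[OF that] e_plus[OF that(4)] by (simp_all add: e_def)
  have crit: "nu2_S_nonconstant k (res_class n (2 ^ m)) \<longleftrightarrow> 2 ^ e j m dvd ?S x"
    if "n \<ge> k" "j \<in> NN k M" "[n = j] (mod 2 ^ M)" "m \<ge> M" "x \<in> res_class n (2 ^ m)" for n j m x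
    unfolding nu2_S_nonconstant_def
  proof (rule nu2_nonconstant_iff_dvd[OF _ const nonconst])
    show "Stirling y k > 0" if "y \<in> res_class n (2 ^ m)" for y
      using that \<open>n \<ge> k\<close> assms(1) by (intro Stirling_pos) (auto simp: res_class_def)
  qed (use that in auto)
  have child: "nu2_S_nonconstant k (res_class n (2 ^ (m + 1))) \<noteq>
               nu2_S_nonconstant k (res_class (n + 2 ^ m) (2 ^ (m + 1)))"
    if m: "m \<ge> M" and n: "n \<ge> k" and nc: "nu2_S_nonconstant k (res_class n (2 ^ m))" for m n
  proof -
    obtain j where j: "j \<in> NN k M" "[n = j] (mod 2 ^ M)"
      using nonconstant_over_NN[OF n m nc] by blast
    \<comment> \<open>The shifted classes lie over the same \<open>j\<close>, hence share the
      exponents \<open>e j m\<close>.\<close>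
    have shift: "[n + i = j] (mod 2 ^ M)" if "2 ^ m dvd i" for i
      using j(2) that m dvd_trans[OF le_imp_power_dvd[OF m] that]
      by (metis add.right_neutral cong_0_iff cong_add)
    let ?A = "res_class n (2 ^ (m + 1))" and ?B = "res_class (n + 2 ^ m) (2 ^ (m + 1))"
    \<comment> \<open>\<open>res_class n t\<close> omits elements below \<open>t\<close>, so the children need not cover \<open>res_class n (2 ^ m)\<close>;
      they do cover the class of the larger representative \<open>n + 2 ^ (m + 1)\<close>.\<close>
    let ?C = "res_class (n + 2 ^ (m + 1)) (2 ^ m)"
    have C_sub: "?C \<subseteq> res_class n (2 ^ m)"
      by (rule res_class_mono) (auto simp: cong_def)
    have "\<not> constant_modulo (?S ` ?C) (2 ^ (e j m + 1))"
      by (rule nonconst) (use n j m shift[of "2 ^ (m + 1)"] in auto)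
    then obtain y z where yz: "y \<in> ?C" "z \<in> ?C" "\<not> [?S y = ?S z] (mod 2 ^ (e j m + 1))"
      by (auto simp: constant_modulo_def)
    have "2 ^ e j m dvd ?S y" "2 ^ e j m dvd ?S z"
      using crit[OF n j m] nc yz C_sub by blast+
    then have differ: "2 ^ (e j m + 1) dvd ?S y \<longleftrightarrow> \<not> 2 ^ (e j m + 1) dvd ?S z"
      using yz(3) by (rule dvd_differs_if_not_cong)
    have critA: "nu2_S_nonconstant k ?A \<longleftrightarrow> 2 ^ (e j m + 1) dvd ?S x" if "x \<in> ?A" for x
      using crit[OF n j, of "m + 1" x] m that e_Suc[OF m] by simp
    have critB: "nu2_S_nonconstant k ?B \<longleftrightarrow> 2 ^ (e j m + 1) dvd ?S x" if "x \<in> ?B" for x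
      using crit[OF _ j(1) shift, of "2 ^ m" "m + 1" x] n m that e_Suc[OF m] by simp
    \<comment> \<open>By \<open>critA\<close> and \<open>critB\<close>, divisibility by
      \<open>2 ^ (e j m + 1)\<close> does not vary within a child, so \<open>y\<close> and
      \<open>z\<close> lie in different children, and exactly one of these is non-constant.\<close>
    show ?thesis
      using in_child_if_in_res_class[OF yz(1)] in_child_if_in_res_class[OF yz(2)]
        differ critA critB by blast
  qed
  have card_NN: "card (NN k m) = card (NN k M)" if "m \<ge> M" for m
    using that
  proof (induction m rule: dec_induct)
    case (step m)
    have "card (NN k (m + 1)) = card (NN k m)"
      by (rule card_NN_Suc, rule child) (use step in \<open>auto simp: NN_def\<close>)
    then show ?case
      using step by simp
  qed simp
  have "AMM_holds_with k M (card (NN k M))"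
    unfolding AMM_holds_with_def
  proof (intro allI impI conjI)
    fix m assume m: "m \<ge> M"
    have "{C. nu2_S_nonconstant k C \<and> (\<exists>n. k \<le> n \<and> n < k + 2 ^ m \<and> C = res_class n (2 ^ m))}
        = (\<lambda>n. res_class n (2 ^ m)) ` NN k m"
      by (auto simp: NN_def)
    moreover have "inj_on (\<lambda>n. res_class n (2 ^ m)) (NN k m)"
      by (rule inj_on_subset[OF inj_on_res_class[of "2 ^ m" k]]) (auto simp: NN_def)
    ultimately show "card {C. nu2_S_nonconstant k C \<and>
        (\<exists>n. k \<le> n \<and> n < k + 2 ^ m \<and> C = res_class n (2 ^ m))} = card (NN k M)"
      by (simp add: card_image card_NN[OF m])
    fix n assume "n \<ge> k" "nu2_S_nonconstant k (res_class n (2 ^ m))"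
    from child[OF m this]
    show "\<exists>!C. C \<in> children n m \<and> nu2_S_nonconstant k C"
      by (auto simp: children_def)
  qed
  moreover have "card {n. k \<le> n \<and> n < k + 2 ^ m \<and> nu2_S_nonconstant k (res_class n (2 ^ m))}
      = card (NN k M)" if "m \<ge> M" for m
    using card_NN[OF that] by (simp only: NN_def[of k m])
  ultimately show ?thesis
    by (intro conjI allI impI exI[of _ M] child order_refl)
qed

end
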